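(* Let $(A,\prec,\succ,\alpha)$ be a Hom-dendriform algebra. Define a linear map $\star\colon A\otimes A\to A$ by $$x\star y=x\prec y+x\succ y$$ for $x,y\in A$. Then $A_a=(A,\star,\alpha)$ is a Hom-associative algebra, hence also a $G$-Hom-associative algebra for every subgroup $G$ of $\mathcal{S}_3$.
   Context: $\mathbb{K}$ is a fixed field of characteristic $0$; all maps are $\mathbb{K}$-linear. A Hom-dendriform algebra is $(A,\prec,\succ,\alpha)$ with $A$ a $\mathbb{K}$-module, linear maps $\prec,\succ\colon A\otimes A\to A$ and $\alpha\colon A\to A$ satisfying, for all $x,y,z\in A$: $(x\prec y)\prec\alpha(z)=\alpha(x)\prec(y\prec z+y\succ z)$; $(x\succ y)\prec\alpha(z)=\alpha(x)\succ(y\prec z)$; $(x\prec y+x\succ y)\succ\alpha(z)=\alpha(x)\succ(y\succ z)$. A Hom-algebra $(A,\mu,\alpha)$ is a $\mathbb{K}$-module $A$ with a bilinear $\mu$ and a linear $\alpha\colon A\to A$. Its Hom-associator is $\mathfrak{as}_A(x_1,x_2,x_3)=\mu(\mu(x_1,x_2),\alpha(x_3))-\mu(\alpha(x_1),\mu(x_2,x_3))$. It is Hom-associative if $\mathfrak{as}_A=0$, and $G$-Hom-associative (for a subgroup $G\leq\mathcal{S}_3$) if $\sum_{\sigma\in G}(-1)^{\varepsilon(\sigma)}\mathfrak{as}_A(x_{\sigma(1)},x_{\sigma(2)},x_{\sigma(3)})=0$ for all $x_i\in A$, where $(-1)^{\varepsilon(\sigma)}$ is the signature of $\sigma$. *)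

theory Defs
  imports Complex_Main "HOL-Algebra.Sym_Groups"
begin

(* A linear map on the tensor product A \<otimes> A is encoded by the corresponding
   bilinear (curried) map. *)
definition bilinear_op ::
  "('k::field \<Rightarrow> 'a::ab_group_add \<Rightarrow> 'a) \<Rightarrow> ('a \<Rightarrow> 'a \<Rightarrow> 'a) \<Rightarrow> bool"
  where "bilinear_op scale m \<longleftrightarrow>
    (\<forall>x. Vector_Spaces.linear scale scale (\<lambda>y. m x y)) \<and>
    (\<forall>y. Vector_Spaces.linear scale scale (\<lambda>x. m x y))"

locale hom_algebra = vector_space scale
  for scale :: "'k::field_char_0 \<Rightarrow> 'a::ab_group_add \<Rightarrow> 'a" +
  fixes mu :: "'a \<Rightarrow> 'a \<Rightarrow> 'a" and alpha :: "'a \<Rightarrow> 'a"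
  assumes bilinear_mu: "bilinear_op scale mu"
    and linear_alpha: "Vector_Spaces.linear scale scale alpha"

definition hom_associator ::
  "('a::ab_group_add \<Rightarrow> 'a \<Rightarrow> 'a) \<Rightarrow> ('a \<Rightarrow> 'a) \<Rightarrow> 'a \<Rightarrow> 'a \<Rightarrow> 'a \<Rightarrow> 'a"
  where "hom_associator mu alpha x y z = mu (mu x y) (alpha z) - mu (alpha x) (mu y z)"

locale hom_associative_algebra = hom_algebra +
  assumes hom_assoc: "hom_associator mu alpha x y z = 0"

(* A triple (x_1, x_2, x_3) is given by a function x on the naturals, of which only
   the values at 1, 2, 3 matter: sym_group 3 consists of the permutations of {1..3}. *)
locale G_hom_associative_algebra = hom_algebra +
  fixes G :: "(nat \<Rightarrow> nat) set"
  assumes subgroup_G: "subgroup G (sym_group 3)"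
    and G_hom_assoc:
      "(\<Sum>\<sigma>\<in>G. scale (of_int (sign \<sigma>))
          (hom_associator mu alpha (x (\<sigma> 1)) (x (\<sigma> 2)) (x (\<sigma> 3)))) = 0"

locale hom_dendriform_algebra = vector_space scale
  for scale :: "'k::field_char_0 \<Rightarrow> 'a::ab_group_add \<Rightarrow> 'a" +
  fixes prec :: "'a \<Rightarrow> 'a \<Rightarrow> 'a" (infixl \<open>\<prec>\<close> 70)
    and succ :: "'a \<Rightarrow> 'a \<Rightarrow> 'a" (infixl \<open>\<succ>\<close> 70)
    and alpha :: "'a \<Rightarrow> 'a"
  assumes bilinear_prec: "bilinear_op scale (\<prec>)"
    and bilinear_succ: "bilinear_op scale (\<succ>)"
    and linear_alpha: "Vector_Spaces.linear scale scale alpha"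
    and prec_prec: "(x \<prec> y) \<prec> alpha z = alpha x \<prec> (y \<prec> z + y \<succ> z)"
    and succ_prec: "(x \<succ> y) \<prec> alpha z = alpha x \<succ> (y \<prec> z)"
    and succ_succ: "(x \<prec> y + x \<succ> y) \<succ> alpha z = alpha x \<succ> (y \<succ> z)"

definition dendriform_star ::
  "('a::ab_group_add \<Rightarrow> 'a \<Rightarrow> 'a) \<Rightarrow> ('a \<Rightarrow> 'a \<Rightarrow> 'a) \<Rightarrow> 'a \<Rightarrow> 'a \<Rightarrow> 'a"
  where "dendriform_star prec succ x y = prec x y + succ x y"

end

theory Submission
  imports Defs
begin

text \<open>Expanding (x \<star> y) \<star> \<alpha>(z) by additivity in the left argument gives
  terms matching the left sides of the three dendriform axioms; the sum of their right sides
  regroups, by additivity in the right argument, into \<alpha>(x) \<star> (y \<star> z). This is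
  \<open>hom_associative_star\<close>. The G-version follows because its signed sum consists of
  Hom-associators, all zero.\<close>

lemma bilinear_op_add_left: "bilinear_op scale m \<Longrightarrow> m (x + y) z = m x z + m y z"
  by (auto simp: bilinear_op_def linear_iff_module_hom dest: module_hom.add)

lemma bilinear_op_add_right: "bilinear_op scale m \<Longrightarrow> m x (y + z) = m x y + m x z"
  by (auto simp: bilinear_op_def linear_iff_module_hom dest: module_hom.add)

lemma (in vector_space) bilinear_op_add:
  assumes "bilinear_op scale m" and "bilinear_op scale n"
  shows "bilinear_op scale (\<lambda>x y. m x y + n x y)"
proof -
  \<comment> \<open>Linear maps are handled as maps between two spaces; here both are the same
    space.\<close>
  interpret vector_space_pair scale scale ..
  show ?thesis
    using assms by (simp add: bilinear_op_def linear_compose_add)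
qed

context hom_dendriform_algebra
begin

lemma hom_algebra_star: "hom_algebra scale (dendriform_star (\<prec>) (\<succ>)) alpha"
proof (intro hom_algebra.intro hom_algebra_axioms.intro vector_space_axioms linear_alpha)
  show "bilinear_op scale (dendriform_star (\<prec>) (\<succ>))"
    using bilinear_op_add[OF bilinear_prec bilinear_succ]
    by (simp add: dendriform_star_def[abs_def])
qed

lemma hom_associative_star:
  "hom_associative_algebra scale (dendriform_star (\<prec>) (\<succ>)) alpha"
proof (intro hom_associative_algebra.intro hom_associative_algebra_axioms.intro hom_algebra_star)
  fix x y z
  \<comment> \<open>Only the \<open>\<prec>\<close> product is split on the left:
    \<open>succ_succ\<close> takes the sum x \<star> y whole.\<close>
  have "(x \<prec> y + x \<succ> y) \<prec> alpha z + (x \<prec> y + x \<succ> y) \<succ> alpha z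
      = alpha x \<prec> (y \<prec> z + y \<succ> z) + alpha x \<succ> (y \<prec> z) + alpha x \<succ> (y \<succ> z)"
    by (simp only: bilinear_op_add_left[OF bilinear_prec] prec_prec succ_prec succ_succ)
  \<comment> \<open>The two \<open>\<succ>\<close> terms merge over their common left factor, so
    that y \<star> z appears in both products.\<close>
  also have "\<dots> = alpha x \<prec> (y \<prec> z + y \<succ> z) + alpha x \<succ> (y \<prec> z + y \<succ> z)"
    by (simp only: bilinear_op_add_right[OF bilinear_succ] add.assoc)
  finally show "hom_associator (dendriform_star (\<prec>) (\<succ>)) alpha x y z = 0"
    by (simp add: hom_associator_def dendriform_star_def)
qed

end

text \<open>Each summand is a multiple of a vanishing Hom-associator, so the alternating sum is zero
  whatever the signs.\<close>

lemma (in hom_associative_algebra) G_hom_associative: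
  assumes "subgroup G (sym_group 3)"
  shows "G_hom_associative_algebra scale mu alpha G"
  using assms
  by (intro G_hom_associative_algebra.intro G_hom_associative_algebra_axioms.intro
      hom_algebra_axioms) (simp_all add: hom_assoc)

theorem theorem6p6:
  fixes scale :: "'k::field_char_0 \<Rightarrow> 'a::ab_group_add \<Rightarrow> 'a"
    and prec succ :: "'a \<Rightarrow> 'a \<Rightarrow> 'a"
    and alpha :: "'a \<Rightarrow> 'a"
  assumes "hom_dendriform_algebra scale prec succ alpha"
  shows "hom_associative_algebra scale (dendriform_star prec succ) alpha \<and>
    (\<forall>G. subgroup G (sym_group 3) \<longrightarrow>
      G_hom_associative_algebra scale (dendriform_star prec succ) alpha G)"
  using hom_dendriform_algebra.hom_associative_star[OF assms]
  by (blast intro: hom_associative_algebra.G_hom_associative)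

end
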